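(* (Doubling the powers.) Let $B_1,\dots,B_n\in\mathbb{C}^{p\times m}$, let $q$ be an integer and let $F(z)=z^{q}\left(z^{-1}B_1+\cdots+z^{-n}B_n\right)$. If $F$ is in $\mathcal{U}$, then for every integer $a$ and every natural number $\gamma\ge1$ the polynomial $$z^{a}\left(z^{-\gamma}B_1+z^{-2\gamma}B_2+\cdots+z^{-n\gamma}B_n\right)$$ is in $\mathcal{U}$.
   Context: With $\mathbb{T}=\{z\in\mathbb{C}:|z|=1\}$, the class $\mathcal{U}$ consists of the $p\times m$-valued rational functions with $F(z)^*F(z)=I_m$ for all $z\in\mathbb{T}$ if $p\ge m$ (isometry), and $F(z)F(z)^*=I_p$ for all $z\in\mathbb{T}$ if $m\ge p$ (co-isometry). *)

theory Defs
  imports "HOL-Analysis.Analysis" "HOL-Computational_Algebra.Polynomial"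
begin

text \<open>A \<open>p \<times> m\<close> complex matrix is an element of \<open>complex ^ 'm ^ 'p\<close>, with
  \<open>p = CARD('p)\<close> and \<open>m = CARD('m)\<close>.\<close>

definition conj_transpose :: "complex ^ 'm ^ 'p \<Rightarrow> complex ^ 'p ^ 'm" where
  "conj_transpose A = (\<chi> i j. cnj (A $ j $ i))"

text \<open>The library's \<open>*s\<close> scales vectors by elements of their entry type only, so scaling a matrix
  by a complex number needs an operation of its own.\<close>

definition scale_matrix :: "complex \<Rightarrow> complex ^ 'm ^ 'p \<Rightarrow> complex ^ 'm ^ 'p"
    (infixr \<open>*\<^sub>C\<close> 75) where
  "c *\<^sub>C A = (\<chi> i j. c * A $ i $ j)"

text \<open>A matrix-valued rational function that is finite at every point of \<open>S\<close>. Functions are total,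
  so the values at the zeros of the denominators are left unconstrained; as no denominator vanishes
  on \<open>S\<close>, the values on \<open>S\<close> are exactly those of the rational function.\<close>

definition rational_regular_on :: "complex set \<Rightarrow> (complex \<Rightarrow> complex ^ 'm ^ 'p) \<Rightarrow> bool" where
  "rational_regular_on S F \<longleftrightarrow>
     (\<forall>i j. \<exists>P Q :: complex poly. Q \<noteq> 0 \<and> (\<forall>z\<in>S. poly Q z \<noteq> 0) \<and>
        (\<forall>z. poly Q z \<noteq> 0 \<longrightarrow> F z $ i $ j = poly P z / poly Q z))"

definition unit_circle :: "complex set" where
  "unit_circle = {z. cmod z = 1}"

text \<open>Regularity on the circle is implicit in demanding the identities at every point of it. For
  \<open>p = m\<close> both identities are demanded.\<close>

definition class_U :: "(complex \<Rightarrow> complex ^ 'm ^ 'p) set" where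
  "class_U = {F. rational_regular_on unit_circle F \<and>
     (CARD('p) \<ge> CARD('m) \<longrightarrow> (\<forall>z\<in>unit_circle. conj_transpose (F z) ** F z = mat 1)) \<and>
     (CARD('m) \<ge> CARD('p) \<longrightarrow> (\<forall>z\<in>unit_circle. F z ** conj_transpose (F z) = mat 1))}"

end

theory Submission
  imports Defs
begin

text \<open>On the unit circle, with \<open>w = z ^ \<gamma>\<close>, which again lies on the circle, the new function is
  \<open>z powi a * w powi (- q)\<close> times \<open>F w\<close>: substituting \<open>z ^ \<gamma>\<close> for \<open>z\<close> multiplies
  every power of \<open>z\<close> by \<open>\<gamma>\<close>. The scalar factor has modulus 1, so it cancels in the products
  that define isometry and co-isometry (\<open>scale_matrix_isometry\<close>, \<open>scale_matrix_coisometry\<close>), and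
  both properties pass from \<open>F\<close> to the new function. Regularity on the circle holds because the
  new function is a Laurent polynomial, whose only possible pole is the origin
  (\<open>rational_regular_on_Laurent\<close>).\<close>

lemma cnj_mult_cancel_unimodular:
  assumes "cmod c = 1"
  shows "cnj (c * x) * (c * y) = cnj x * y"
proof -
  have "cnj c * c = 1"
    using assms by (simp add: mult.commute flip: complex_norm_square)
  then show ?thesis
    by (metis complex_cnj_mult mult.assoc mult.commute mult.left_neutral)
qed

lemma scale_matrix_isometry:
  assumes "cmod c = 1"
  shows "conj_transpose (c *\<^sub>C A) ** (c *\<^sub>C A) = conj_transpose A ** A"
  by (simp only: vec_eq_iff matrix_matrix_mult_def conj_transpose_def scale_matrix_def
      vec_lambda_beta cnj_mult_cancel_unimodular[OF assms]) simp

lemma scale_matrix_coisometry: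
  assumes "cmod c = 1"
  shows "(c *\<^sub>C A) ** conj_transpose (c *\<^sub>C A) = A ** conj_transpose A"
  by (simp only: vec_eq_iff matrix_matrix_mult_def conj_transpose_def scale_matrix_def
      vec_lambda_beta mult.commute[of "c * _" "cnj _"] cnj_mult_cancel_unimodular[OF assms])
    (simp add: mult.commute)

lemma scale_matrix_scale_matrix: "c *\<^sub>C (d *\<^sub>C A) = (c * d) *\<^sub>C A"
  by (simp add: scale_matrix_def vec_eq_iff mult.assoc)

lemma rational_regular_on_Laurent:
  fixes B :: "'k \<Rightarrow> complex ^ 'm ^ 'p" and e :: "'k \<Rightarrow> int"
  assumes "finite K" and "0 \<notin> S"
  shows "rational_regular_on S (\<lambda>z. z powi a *\<^sub>C (\<Sum>k\<in>K. z powi e k *\<^sub>C B k))"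
  unfolding rational_regular_on_def
proof (intro allI)
  fix i j
  define N where "N = Suc (\<Sum>k\<in>K. nat \<bar>a + e k\<bar>)"
  define P where "P = (\<Sum>k\<in>K. monom (B k $ i $ j) (nat (int N + a + e k)))"
  \<comment> \<open>The exponent \<open>N\<close> is positive, so \<open>Q\<close> vanishes at 0, where the values of negative powers
    are mere conventions and the quotient need not agree with them.\<close>
  define Q where "Q = (monom 1 N :: complex poly)"
  have exponent: "int N + a + e k \<ge> 0" if "k \<in> K" for k
  proof -
    have "nat \<bar>a + e k\<bar> \<le> (\<Sum>k\<in>K. nat \<bar>a + e k\<bar>)"
      using assms(1) that by (intro member_le_sum) auto
    then show ?thesis
      unfolding N_def by linarith
  qed
  have poly_Q: "poly Q z = z ^ N" for z
    by (simp add: Q_def poly_monom)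
  have quotient: "(z powi a *\<^sub>C (\<Sum>k\<in>K. z powi e k *\<^sub>C B k)) $ i $ j = poly P z / poly Q z"
    if "poly Q z \<noteq> 0" for z
  proof -
    have z: "z \<noteq> 0"
      using that by (auto simp: poly_Q N_def)
    have "poly P z = (\<Sum>k\<in>K. z powi (int N + a + e k) * B k $ i $ j)"
      unfolding P_def poly_sum
      by (intro sum.cong refl) (simp add: poly_monom power_int_def exponent)
    also have "\<dots> = z ^ N * (z powi a * (\<Sum>k\<in>K. z powi e k * B k $ i $ j))"
      using z by (simp add: power_int_add sum_distrib_left mult.assoc)
    finally show ?thesis
      using z by (simp add: poly_Q scale_matrix_def)
  qed
  have "Q \<noteq> 0" "\<forall>z\<in>S. poly Q z \<noteq> 0"
    using assms(2) by (auto simp: Q_def poly_monom monom_eq_0_iff)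
  with quotient show "\<exists>P Q. Q \<noteq> 0 \<and> (\<forall>z\<in>S. poly Q z \<noteq> 0) \<and> (\<forall>z. poly Q z \<noteq> 0 \<longrightarrow>
      (z powi a *\<^sub>C (\<Sum>k\<in>K. z powi e k *\<^sub>C B k)) $ i $ j = poly P z / poly Q z)"
    by blast
qed

theorem mainTheorem7:
  fixes B :: "nat \<Rightarrow> complex ^ 'm ^ 'p" and n :: nat and q :: int
    and F :: "complex \<Rightarrow> complex ^ 'm ^ 'p"
  assumes "F = (\<lambda>z. z powi q *\<^sub>C (\<Sum>k=1..n. z powi (- int k) *\<^sub>C B k))"
    and "F \<in> class_U"
  shows "\<forall>a::int. \<forall>\<gamma>::nat. \<gamma> \<ge> 1 \<longrightarrow>
    (\<lambda>z. z powi a *\<^sub>C (\<Sum>k=1..n. z powi (- int (k * \<gamma>)) *\<^sub>C B k)) \<in> class_U"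
proof (intro allI impI)
  fix a :: int and \<gamma> :: nat
  define G where "G = (\<lambda>z. z powi a *\<^sub>C (\<Sum>k=1..n. z powi (- int (k * \<gamma>)) *\<^sub>C B k))"
  have G_eq: "\<exists>c w. cmod c = 1 \<and> w \<in> unit_circle \<and> G z = c *\<^sub>C F w" if "z \<in> unit_circle" for z
  proof -
    define w where "w = z ^ \<gamma>"
    have norm_z: "cmod z = 1" and norm_w: "cmod w = 1"
      using that by (auto simp: unit_circle_def w_def norm_power)
    have "w powi (- int k) = z powi (- int (k * \<gamma>))" for k
      by (simp add: w_def power_int_minus power_int_mult mult.commute)
    moreover have "w powi (- q) * w powi q = 1"
      using norm_w by (subst power_int_add[symmetric]) auto
    ultimately have "G z = (z powi a * w powi (- q)) *\<^sub>C F w"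
      by (simp add: G_def assms(1) scale_matrix_scale_matrix mult.assoc)
    moreover have "cmod (z powi a * w powi (- q)) = 1"
      using norm_z norm_w by (simp add: norm_mult norm_power_int)
    ultimately show ?thesis
      using norm_w by (auto simp: unit_circle_def)
  qed
  have "rational_regular_on unit_circle G"
    unfolding G_def by (rule rational_regular_on_Laurent) (auto simp: unit_circle_def)
  moreover have "conj_transpose (G z) ** G z = mat 1"
    if "CARD('p) \<ge> CARD('m)" "z \<in> unit_circle" for z
    using G_eq[OF that(2)] that(1) assms(2)
    by (auto simp: class_U_def scale_matrix_isometry)
  moreover have "G z ** conj_transpose (G z) = mat 1"
    if "CARD('m) \<ge> CARD('p)" "z \<in> unit_circle" for z
    using G_eq[OF that(2)] that(1) assms(2)
    by (auto simp: class_U_def scale_matrix_coisometry)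
  ultimately have "G \<in> class_U"
    by (simp add: class_U_def)
  then show "(\<lambda>z. z powi a *\<^sub>C (\<Sum>k=1..n. z powi (- int (k * \<gamma>)) *\<^sub>C B k)) \<in> class_U"
    by (simp only: G_def)
qed

end
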